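(* Let $G=(V,E)$ be a finite simple graph with $V=\{v_1,\dots,v_n\}$, let $m\ge 1$, and let $k_1,\dots,k_n$ be integers with $0\le k_i\le m$. For each $i$ let $E_{\mathrm{mix}}^{(i)}$ be a set of unordered pairs of distinct elements of $\{1,\dots,m\}$, and let $$H_{XY}=\frac12\sum_{i=1}^n\ \sum_{(c,c')\in E_{\mathrm{mix}}^{(i)}}\bigl(\sigma^x_{(i,c)}\sigma^x_{(i,c')}+\sigma^y_{(i,c)}\sigma^y_{(i,c')}\bigr)$$ act on the $nm$ qubits indexed by pairs $(i,c)$. Then $H_{XY}$ commutes with the node-wise number operator $\hat N_i=\sum_{c=1}^m \hat n_{i,c}$ for every $i\in\{1,\dots,n\}$. Consequently, for every $p\ge 1$ and all $\boldsymbol\gamma,\boldsymbol\beta\in\mathbb{R}^p$, the state $$|\psi(\boldsymbol\gamma,\boldsymbol\beta)\rangle=e^{-i\beta_pH_{XY}}e^{-i\gamma_pH_P}\cdots e^{-i\beta_1H_{XY}}e^{-i\gamma_1H_P}\ \bigotimes_{i=1}^n|D^m_{k_i}\rangle_{v_i}$$ lies in $\mathcal{H}_{\mathrm{feas}}$, so that every bitstring $x$ obtained with nonzero probability when measuring it in the computational basis satisfies $\sum_{c=1}^m x_{i,c}=k_i$ for all $i$.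
   Context: There is one qubit $(i,c)$ for each node $v_i$ ($1\le i\le n$) and each channel $c\in\{1,\dots,m\}$; computational basis states $|x\rangle$ are labelled by binary arrays $x=(x_{i,c})\in\{0,1\}^{n\times m}$. The $m$ qubits $(i,1),\dots,(i,m)$ form the register of node $v_i$. $\sigma^x,\sigma^y,\sigma^z$ with a subscript $(i,c)$ denote the Pauli operators on qubit $(i,c)$, and $\hat n_{i,c}=\tfrac12(I-\sigma^z_{(i,c)})$ is the number operator, so $\hat n_{i,c}|x\rangle=x_{i,c}|x\rangle$. The Generalized Dicke state on $m$ qubits with weight $k$ is $|D^m_k\rangle=\binom{m}{k}^{-1/2}\sum_{x\in\{0,1\}^m,\ \mathrm{wt}(x)=k}|x\rangle$, where $\mathrm{wt}$ is the Hamming weight; $|D^m_{k_i}\rangle_{v_i}$ is this state on the register of $v_i$. $H_P$ is the conflict-counting problem Hamiltonian, diagonal in the computational basis, with $H_P|x\rangle=C(x)|x\rangle$, where $C(x)=\sum_{(v_i,v_j)\in E}\sum_{c=1}^m x_{i,c}x_{j,c}$ (each edge counted once). The feasible set is $\mathcal F=\{x\in\{0,1\}^{n\times m}:\ \sum_{c=1}^m x_{i,c}=k_i \text{ for all } i\}$, and $\mathcal H_{\mathrm{feas}}$ is the complex linear span of $\{|x\rangle: x\in\mathcal F\}$. *)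

theory Defs
  imports "HOL-Analysis.Analysis"
begin

text \<open>
  The qubits are indexed by a finite type \<open>'q\<close>; a computational basis label is a bit
  assignment \<open>'q \<Rightarrow> bool\<close>. States are complex vectors, and operators are complex matrices,
  indexed by the basis labels. For the register of all nodes, \<open>'q\<close> is \<open>'n \<times> 'm\<close> (node, channel);
  for the register of a single node it is \<open>'m\<close>.
\<close>

type_synonym 'q qstate = "complex ^ ('q \<Rightarrow> bool)"
type_synonym 'q qop = "complex ^ ('q \<Rightarrow> bool) ^ ('q \<Rightarrow> bool)"

definition ket :: "('q::finite \<Rightarrow> bool) \<Rightarrow> 'q qstate" where
  "ket x = axis x 1"

definition scale_mat :: "complex \<Rightarrow> complex ^ 'b::finite ^ 'a::finite \<Rightarrow> complex ^ 'b ^ 'a" where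
  "scale_mat a A = (\<chi> i j. a * A $ i $ j)"


subsection \<open>Matrix exponential\<close>

primrec mat_power :: "complex ^ 'a::finite ^ 'a \<Rightarrow> nat \<Rightarrow> complex ^ 'a ^ 'a" where
  "mat_power A 0 = mat 1"
| "mat_power A (Suc k) = A ** mat_power A k"

definition mat_exp :: "complex ^ 'a::finite ^ 'a \<Rightarrow> complex ^ 'a ^ 'a" where
  "mat_exp A = (\<Sum>k. (1 / fact k) *\<^sub>R mat_power A k)"

lemma norm_le_sum_norm_vec:
  fixes v :: "'b::real_normed_vector ^ 'a::finite"
  shows "norm v \<le> (\<Sum>i\<in>UNIV. norm (v $ i))"
  by (simp add: norm_vec_def L2_set_le_sum)

text \<open>The defining series converges, so \<open>mat_exp\<close> is the genuine exponential.\<close>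

lemma summable_mat_exp:
  fixes A :: "complex ^ 'a::finite ^ 'a"
  shows "summable (\<lambda>k. (1 / fact k) *\<^sub>R mat_power A k)"
proof -
  define B where "B = (\<Sum>i\<in>UNIV. \<Sum>j\<in>UNIV. norm (A $ i $ j))"
  define N where "N = real CARD('a)"
  have row: "(\<Sum>j\<in>UNIV. norm (A $ i $ j)) \<le> B" for i
    unfolding B_def by (rule member_le_sum) (auto intro: sum_nonneg)
  have B0: "B \<ge> 0"
    unfolding B_def by (intro sum_nonneg) auto
  have entry: "norm (mat_power A k $ i $ j) \<le> B ^ k" for k i j
  proof (induction k arbitrary: i)
    case 0
    show ?case by (simp add: mat_def)
  next
    case (Suc k)
    have "norm (mat_power A (Suc k) $ i $ j)
        \<le> (\<Sum>l\<in>UNIV. norm (A $ i $ l) * norm (mat_power A k $ l $ j))"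
      unfolding mat_power.simps matrix_matrix_mult_def
      by (simp add: sum_norm_le norm_mult)
    also have "\<dots> \<le> (\<Sum>l\<in>UNIV. norm (A $ i $ l) * B ^ k)"
      by (intro sum_mono mult_left_mono Suc.IH) auto
    also have "\<dots> \<le> B * B ^ k"
      using row[of i] B0 by (simp add: sum_distrib_right[symmetric] mult_right_mono)
    finally show ?case by simp
  qed
  have "norm ((1 / fact k) *\<^sub>R mat_power A k) \<le> (N * N) * (B ^ k /\<^sub>R fact k)" for k
  proof -
    have "norm (mat_power A k) \<le> (\<Sum>i\<in>UNIV. \<Sum>j\<in>UNIV. norm (mat_power A k $ i $ j))"
      by (rule order_trans[OF norm_le_sum_norm_vec sum_mono[OF norm_le_sum_norm_vec]])
    also have "\<dots> \<le> (\<Sum>i\<in>(UNIV::'a set). \<Sum>j\<in>(UNIV::'a set). B ^ k)"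
      by (intro sum_mono entry)
    finally have "norm (mat_power A k) \<le> N * N * B ^ k"
      by (simp add: N_def mult.assoc)
    then show ?thesis
      by (simp add: divide_simps)
  qed
  then show ?thesis
    by (intro summable_comparison_test'[OF summable_mult[OF summable_exp_generic]])
qed


subsection \<open>Pauli and number operators\<close>

text \<open>Single-qubit matrices have the rows and columns \<open>False\<close> for \<open>|0\<rangle>\<close> and \<open>True\<close> for \<open>|1\<rangle>\<close>.\<close>

definition pauli_x :: "complex ^ bool ^ bool" where
  "pauli_x = (\<chi> a b. if a \<noteq> b then 1 else 0)"

definition pauli_y :: "complex ^ bool ^ bool" where
  "pauli_y = (\<chi> a b. if a = b then 0 else if a then \<i> else - \<i>)"

definition pauli_z :: "complex ^ bool ^ bool" where
  "pauli_z = (\<chi> a b. if a \<noteq> b then 0 else if a then - 1 else 1)"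

text \<open>The operator acting as \<open>A\<close> on qubit \<open>q\<close> and as the identity on all other qubits.\<close>

definition on_qubit :: "complex ^ bool ^ bool \<Rightarrow> 'q::finite \<Rightarrow> 'q qop" where
  "on_qubit A q = (\<chi> y x. if \<forall>r. r \<noteq> q \<longrightarrow> y r = x r then A $ y q $ x q else 0)"

definition sigma_x :: "'q::finite \<Rightarrow> 'q qop" where
  "sigma_x q = on_qubit pauli_x q"

definition sigma_y :: "'q::finite \<Rightarrow> 'q qop" where
  "sigma_y q = on_qubit pauli_y q"

definition sigma_z :: "'q::finite \<Rightarrow> 'q qop" where
  "sigma_z q = on_qubit pauli_z q"

definition number_op :: "'q::finite \<Rightarrow> 'q qop" where
  "number_op q = scale_mat (1/2) (mat 1 - sigma_z q)"

definition node_number_op :: "'n::finite \<Rightarrow> ('n \<times> 'm::finite) qop" where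
  "node_number_op i = (\<Sum>c\<in>UNIV. number_op (i, c))"

lemma on_qubit_mult_vec:
  "(on_qubit A q *v \<psi>) $ y = (\<Sum>b\<in>UNIV. A $ y q $ b * \<psi> $ (y(q := b)))"
proof -
  let ?S = "{x. \<forall>r. r \<noteq> q \<longrightarrow> y r = x r}"
  have S: "?S = (\<lambda>b. y(q := b)) ` UNIV"
  proof (intro equalityI subsetI)
    fix x assume "x \<in> ?S"
    then have "x = y(q := x q)" by (intro ext) auto
    then show "x \<in> (\<lambda>b. y(q := b)) ` UNIV" by blast
  qed auto
  have inj: "inj (\<lambda>b. y(q := b))"
    by (rule injI) (metis fun_upd_same)
  have "(on_qubit A q *v \<psi>) $ y = (\<Sum>x\<in>?S. A $ y q $ x q * \<psi> $ x)"
    unfolding on_qubit_def matrix_vector_mult_def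
    by (simp, intro sum.mono_neutral_cong_right) auto
  also have "\<dots> = (\<Sum>b\<in>UNIV. A $ y q $ b * \<psi> $ (y(q := b)))"
    unfolding S by (subst sum.reindex[OF inj]) simp
  finally show ?thesis .
qed

lemma on_qubit_commute:
  assumes "q \<noteq> r"
  shows "on_qubit A q ** on_qubit B r = on_qubit B r ** on_qubit A q"
proof -
  have "(on_qubit A q *v (on_qubit B r *v \<psi>)) $ y = (on_qubit B r *v (on_qubit A q *v \<psi>)) $ y"
    for \<psi> y
  proof -
    have "(on_qubit A q *v (on_qubit B r *v \<psi>)) $ y
        = (\<Sum>a\<in>UNIV. \<Sum>b\<in>UNIV. A $ y q $ a * (B $ y r $ b * \<psi> $ (y(q := a, r := b))))"
      using assms by (simp add: on_qubit_mult_vec sum_distrib_left)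
    also have "\<dots> = (\<Sum>b\<in>UNIV. \<Sum>a\<in>UNIV. B $ y r $ b * (A $ y q $ a * \<psi> $ (y(r := b, q := a))))"
      by (subst sum.swap) (simp add: fun_upd_twist[OF assms] mult.left_commute)
    also have "\<dots> = (on_qubit B r *v (on_qubit A q *v \<psi>)) $ y"
      using assms by (simp add: on_qubit_mult_vec sum_distrib_left)
    finally show ?thesis .
  qed
  then show ?thesis
    by (simp add: matrix_eq vec_eq_iff matrix_vector_mul_assoc[symmetric])
qed


subsection \<open>XY mixer\<close>

definition xy_term :: "'n::finite \<Rightarrow> 'm::finite \<Rightarrow> 'm \<Rightarrow> ('n \<times> 'm) qop" where
  "xy_term i c c' = sigma_x (i, c) ** sigma_x (i, c') + sigma_y (i, c) ** sigma_y (i, c')"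

text \<open>
  The XY term of an unordered pair \<open>e\<close>. It does not depend on the order in which the two elements
  of \<open>e\<close> are taken, see \<open>xy_pair_doubleton\<close> below.
\<close>

definition xy_pair :: "'n::finite \<Rightarrow> 'm::finite set \<Rightarrow> ('n \<times> 'm) qop" where
  "xy_pair i e = (THE T. \<exists>c c'. c \<noteq> c' \<and> e = {c, c'} \<and> T = xy_term i c c')"

lemma xy_term_commute: "xy_term i c c' = xy_term i c' c"
proof (cases "c = c'")
  case False
  then have "(i, c) \<noteq> (i, c')" by simp
  then show ?thesis
    unfolding xy_term_def sigma_x_def sigma_y_def by (metis on_qubit_commute)
qed simp

lemma xy_pair_doubleton:
  assumes "c \<noteq> c'"
  shows "xy_pair i {c, c'} = xy_term i c c'"
  unfolding xy_pair_def
proof (rule the_equality)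
  show "\<exists>d d'. d \<noteq> d' \<and> {c, c'} = {d, d'} \<and> xy_term i c c' = xy_term i d d'"
    using assms by blast
next
  fix T assume "\<exists>d d'. d \<noteq> d' \<and> {c, c'} = {d, d'} \<and> T = xy_term i d d'"
  then show "T = xy_term i c c'"
    by (auto simp: doubleton_eq_iff xy_term_commute)
qed

definition H_XY :: "('n::finite \<Rightarrow> 'm::finite set set) \<Rightarrow> ('n \<times> 'm) qop" where
  "H_XY Emix = scale_mat (1/2) (\<Sum>i\<in>UNIV. \<Sum>e\<in>Emix i. xy_pair i e)"


subsection \<open>Problem Hamiltonian\<close>

text \<open>For an edge \<open>e = {i, j}\<close> with \<open>i \<noteq> j\<close> the inner product is \<open>x\<^bsub>i,c\<^esub> x\<^bsub>j,c\<^esub>\<close>.\<close>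

definition conflicts :: "'n::finite set set \<Rightarrow> ('n \<times> 'm::finite \<Rightarrow> bool) \<Rightarrow> nat" where
  "conflicts E x = (\<Sum>e\<in>E. \<Sum>c\<in>UNIV. \<Prod>i\<in>e. of_bool (x (i, c)))"

definition H_P :: "'n::finite set set \<Rightarrow> ('n \<times> 'm::finite) qop" where
  "H_P E = (\<chi> y x. if y = x then of_nat (conflicts E x) else 0)"


subsection \<open>Initial state, circuit, feasible subspace, measurement\<close>

definition hamming_wt :: "('m::finite \<Rightarrow> bool) \<Rightarrow> nat" where
  "hamming_wt x = (\<Sum>c\<in>UNIV. of_bool (x c))"

definition dicke :: "nat \<Rightarrow> 'm::finite qstate" where
  "dicke k = complex_of_real (1 / sqrt (real (CARD('m) choose k)))
               *s (\<Sum>x | hamming_wt x = k. ket x)"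

definition tensor_nodes :: "('n::finite \<Rightarrow> 'm::finite qstate) \<Rightarrow> ('n \<times> 'm) qstate" where
  "tensor_nodes \<phi> = (\<chi> x. \<Prod>i\<in>UNIV. \<phi> i $ (\<lambda>c. x (i, c)))"

text \<open>Only the angles with indices \<open>1, \<dots>, p\<close> enter into \<open>qaoa_state E Emix k \<gamma> \<beta> p\<close>.\<close>

primrec qaoa_state ::
  "'n::finite set set \<Rightarrow> ('n \<Rightarrow> 'm::finite set set) \<Rightarrow> ('n \<Rightarrow> nat) \<Rightarrow>
   (nat \<Rightarrow> real) \<Rightarrow> (nat \<Rightarrow> real) \<Rightarrow> nat \<Rightarrow> ('n \<times> 'm) qstate" where
  "qaoa_state E Emix k \<gamma> \<beta> 0 = tensor_nodes (\<lambda>i. dicke (k i))"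
| "qaoa_state E Emix k \<gamma> \<beta> (Suc p) =
     mat_exp (scale_mat (- \<i> * complex_of_real (\<beta> (Suc p))) (H_XY Emix)) *v
       (mat_exp (scale_mat (- \<i> * complex_of_real (\<gamma> (Suc p))) (H_P E)) *v
         qaoa_state E Emix k \<gamma> \<beta> p)"

definition feasible :: "('n::finite \<Rightarrow> nat) \<Rightarrow> ('n \<times> 'm::finite \<Rightarrow> bool) set" where
  "feasible k = {x. \<forall>i. (\<Sum>c\<in>UNIV. of_bool (x (i, c))) = k i}"

definition H_feas :: "('n::finite \<Rightarrow> nat) \<Rightarrow> ('n \<times> 'm::finite) qstate set" where
  "H_feas k = vec.span (ket ` feasible k)"

definition outcome_prob :: "'q::finite qstate \<Rightarrow> ('q \<Rightarrow> bool) \<Rightarrow> real" where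
  "outcome_prob \<psi> x = (cmod (\<psi> $ x))\<^sup>2"

end

(*
  Call the vector of Hamming weights of the node registers the label of a basis state. An XY term only
  moves an excitation between two channels of one node, so all nonzero entries of H_XY connect
  basis states with equal labels; the same holds for the diagonal matrix H_P. Such block diagonal
  matrices are closed under products and limits, hence contain the exponentials, they commute with
  every diagonal matrix that depends on the label only, and they map the span of the basis states
  with a given label to itself.
*)
theory Submission
  imports Defs
begin

text \<open>The blocks are the fibres of \<open>f\<close>. Phrased entrywise, the notion requires no
  ordering of the basis labels that would make the blocks contiguous.\<close>

definition block_diagonal :: "('a \<Rightarrow> 'l) \<Rightarrow> complex ^ 'a::finite ^ 'a \<Rightarrow> bool" where
  "block_diagonal f A \<longleftrightarrow> (\<forall>y x. A $ y $ x \<noteq> 0 \<longrightarrow> f y = f x)"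

definition supported_on :: "'a set \<Rightarrow> complex ^ 'a::finite \<Rightarrow> bool" where
  "supported_on S \<psi> \<longleftrightarrow> (\<forall>x. \<psi> $ x \<noteq> 0 \<longrightarrow> x \<in> S)"

lemma block_diagonal_zero: "block_diagonal f 0"
  by (simp add: block_diagonal_def)

lemma block_diagonal_mat: "block_diagonal f (mat a)"
  by (simp add: block_diagonal_def mat_def)

lemma block_diagonal_add:
  "block_diagonal f A \<Longrightarrow> block_diagonal f B \<Longrightarrow> block_diagonal f (A + B)"
  unfolding block_diagonal_def by (metis add.left_neutral vector_add_component)

lemma block_diagonal_sum:
  assumes "\<And>i. i \<in> I \<Longrightarrow> block_diagonal f (A i)"
  shows "block_diagonal f (\<Sum>i\<in>I. A i)"
  using assms
  by (induction I rule: infinite_finite_induct) (simp_all add: block_diagonal_zero block_diagonal_add)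

lemma block_diagonal_scale_mat: "block_diagonal f A \<Longrightarrow> block_diagonal f (scale_mat a A)"
  unfolding block_diagonal_def scale_mat_def by simp

text \<open>A nonzero entry of the product has a nonzero summand, whose middle index
  \<open>z\<close> shares its label with both \<open>y\<close> and \<open>x\<close>.\<close>

lemma block_diagonal_mult:
  assumes "block_diagonal f A" "block_diagonal f B"
  shows "block_diagonal f (A ** B)"
  unfolding block_diagonal_def
proof (intro allI impI)
  fix y x assume "(A ** B) $ y $ x \<noteq> 0"
  then obtain z where "A $ y $ z * B $ z $ x \<noteq> 0"
    unfolding matrix_matrix_mult_def by (auto elim: sum.not_neutral_contains_not_neutral)
  then show "f y = f x"
    using assms unfolding block_diagonal_def by (metis mult_zero_left mult_zero_right)
qed

lemma block_diagonal_mat_power: "block_diagonal f A \<Longrightarrow> block_diagonal f (mat_power A k)"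
  by (induction k) (simp_all add: block_diagonal_mat block_diagonal_mult)

text \<open>Reading off an entry is a bounded linear map, so it may be applied to the convergent
  exponential series term by term.\<close>

lemma mat_exp_nth:
  "mat_exp A $ y $ x = (\<Sum>k. (1 / fact k) *\<^sub>R mat_power A k $ y $ x)"
  unfolding mat_exp_def
  using bounded_linear.suminf[OF bounded_linear_compose[OF bounded_linear_vec_nth[of x] bounded_linear_vec_nth[of y]]
      summable_mat_exp, of A]
  by simp

lemma block_diagonal_mat_exp:
  assumes "block_diagonal f A"
  shows "block_diagonal f (mat_exp A)"
  unfolding block_diagonal_def
proof (intro allI impI, rule ccontr)
  fix y x assume "mat_exp A $ y $ x \<noteq> 0" "f y \<noteq> f x"
  moreover have "mat_power A k $ y $ x = 0" for k
    using block_diagonal_mat_power[OF assms] \<open>f y \<noteq> f x\<close> unfolding block_diagonal_def by blast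
  ultimately show False by (simp add: mat_exp_nth)
qed

text \<open>Multiplying by the diagonal matrix on the right scales column \<open>x\<close> by
  \<open>g (f x)\<close>, on the left row \<open>y\<close> by \<open>g (f y)\<close>. The two
  factors agree wherever \<open>A\<close> has a nonzero entry.\<close>

lemma block_diagonal_commute:
  assumes "block_diagonal f A"
  shows "A ** (\<chi> y x. if y = x then g (f x) else 0) = (\<chi> y x. if y = x then g (f x) else 0) ** A"
    (is "A ** ?D = ?D ** A")
proof -
  have "(A ** ?D) $ y $ x = (?D ** A) $ y $ x" for y x
  proof -
    have "(A ** ?D) $ y $ x = A $ y $ x * g (f x)"
      by (simp add: matrix_matrix_mult_def if_distrib[of "\<lambda>t. _ * t"] cong: if_cong)
    moreover have "(?D ** A) $ y $ x = g (f y) * A $ y $ x"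
      by (simp add: matrix_matrix_mult_def if_distrib[of "\<lambda>t. t * _"] cong: if_cong)
    moreover have "f y = f x" if "A $ y $ x \<noteq> 0"
      using assms that unfolding block_diagonal_def by blast
    ultimately show ?thesis
      by (cases "A $ y $ x = 0") simp_all
  qed
  then show ?thesis by (simp add: vec_eq_iff)
qed

lemma block_diagonal_supported_on:
  assumes "block_diagonal f A" "supported_on {x. f x = l} \<psi>"
  shows "supported_on {x. f x = l} (A *v \<psi>)"
  unfolding supported_on_def
proof (intro allI impI)
  fix y assume "(A *v \<psi>) $ y \<noteq> 0"
  then obtain z where "A $ y $ z * \<psi> $ z \<noteq> 0"
    unfolding matrix_vector_mult_def by (auto elim: sum.not_neutral_contains_not_neutral)
  then show "y \<in> {x. f x = l}"
    using assms unfolding block_diagonal_def supported_on_def by fastforce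
qed

lemma supported_on_imp_span_ket:
  assumes "supported_on S \<psi>"
  shows "\<psi> \<in> vec.span (ket ` S)"
proof -
  have "\<psi> = (\<Sum>x\<in>UNIV. \<psi> $ x *s ket x)"
    unfolding ket_def by (rule basis_expansion[symmetric])
  also have "\<dots> = (\<Sum>x\<in>S. \<psi> $ x *s ket x)"
    using assms unfolding supported_on_def by (intro sum.mono_neutral_right) auto
  also have "\<dots> \<in> vec.span (ket ` S)"
    by (intro vec.span_sum vec.span_scale vec.span_base) auto
  finally show ?thesis .
qed

text \<open>This is the label used for the blocks. It is curried so that
  \<open>node_weights x\<close> is the whole weight vector and feasibility becomes the single
  equation \<open>node_weights x = k\<close>.\<close>

definition node_weights :: "('n::finite \<times> 'm::finite \<Rightarrow> bool) \<Rightarrow> 'n \<Rightarrow> nat" where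
  "node_weights x i = (\<Sum>c\<in>UNIV. of_bool (x (i, c)))"

lemma feasible_eq: "feasible k = {x. node_weights x = k}"
  by (auto simp: feasible_def node_weights_def fun_eq_iff)

lemma number_op_eq: "number_op q = (\<chi> y x. if y = x then of_bool (x q) else 0)"
proof -
  \<comment> \<open>Hence \<open>on_qubit\<close> turns the diagonal matrix \<open>pauli_z\<close>
    into a diagonal matrix.\<close>
  have "y = x" if "\<forall>r. r \<noteq> q \<longrightarrow> y r = x r" "y q = x q" for x y :: "'a \<Rightarrow> bool"
    using that by (intro ext) metis
  then show ?thesis
    unfolding number_op_def scale_mat_def sigma_z_def on_qubit_def pauli_z_def mat_def
    by (auto simp: vec_eq_iff)
qed

lemma node_number_op_eq:
  "node_number_op i = (\<chi> y x. if y = x then of_nat (node_weights x i) else 0)"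
  unfolding node_number_op_def number_op_eq node_weights_def vec_eq_iff
  by simp

text \<open>Flipping two unequal bits amounts to swapping them, and a permutation of the channels of
  node \<open>i\<close> preserves its weight.\<close>

lemma node_weights_exchange:
  assumes "y (i, c) \<noteq> y (i, c')"
  shows "node_weights (y((i, c) := \<not> y (i, c), (i, c') := \<not> y (i, c'))) = node_weights y"
proof
  fix j
  let ?y = "y((i, c) := \<not> y (i, c), (i, c') := \<not> y (i, c'))"
  show "node_weights ?y j = node_weights y j"
  proof (cases "j = i")
    case True
    have "?y (i, d) = y (i, Transposition.transpose c c' d)" for d
      using assms by (cases "d = c"; cases "d = c'") (simp_all add: Transposition.transpose_def)
    then have "node_weights ?y i = (\<Sum>d\<in>UNIV. of_bool (y (i, Transposition.transpose c c' d)))"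
      by (simp only: node_weights_def)
    also have "\<dots> = node_weights y i"
      unfolding node_weights_def
      by (rule sum.reindex_bij_betw[where h = "Transposition.transpose c c'"]) simp
    finally show ?thesis using True by simp
  next
    case False
    then show ?thesis by (simp add: node_weights_def)
  qed
qed

text \<open>Both products flip the two bits. The XX coefficient is 1; the YY coefficient is
  (\<plusminus>\<i>)(\<plusminus>\<i>) = -1 for equal bits and \<i>(-\<i>) = 1 for unequal ones, so
  the sum is 0 or 2.\<close>

lemma xy_term_mult_vec:
  assumes "c \<noteq> c'"
  shows "(xy_term i c c' *v \<psi>) $ y =
    (if y (i, c) = y (i, c') then 0
     else 2 * \<psi> $ (y((i, c) := \<not> y (i, c), (i, c') := \<not> y (i, c'))))"
  using assms
  unfolding xy_term_def sigma_x_def sigma_y_def matrix_vector_mult_add_rdistrib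
    matrix_vector_mul_assoc[symmetric]
  by (cases "y (i, c)"; cases "y (i, c')")
    (simp_all add: on_qubit_mult_vec pauli_x_def pauli_y_def UNIV_bool)

lemma block_diagonal_xy_term:
  assumes "c \<noteq> c'"
  shows "block_diagonal node_weights (xy_term i c c')"
  unfolding block_diagonal_def
proof (intro allI impI)
  fix y x assume "xy_term i c c' $ y $ x \<noteq> 0"
  \<comment> \<open>The entry is rewritten as an amplitude of the image of a basis state, to which
    \<open>xy_term_mult_vec\<close> applies.\<close>
  then have "(xy_term i c c' *v ket x) $ y \<noteq> 0"
    by (simp add: ket_def axis_def matrix_vector_mult_def if_distrib cong: if_cong)
  then have "y (i, c) \<noteq> y (i, c')" "x = y((i, c) := \<not> y (i, c), (i, c') := \<not> y (i, c'))"
    unfolding xy_term_mult_vec[OF assms] by (auto simp: ket_def axis_def split: if_splits)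
  then show "node_weights y = node_weights x"
    using node_weights_exchange by metis
qed

lemma block_diagonal_H_XY:
  assumes "\<forall>i. \<forall>e\<in>Emix i. card e = 2"
  shows "block_diagonal node_weights (H_XY Emix)"
proof -
  \<comment> \<open>A set of cardinality 2 is a doubleton of distinct channels, which resolves the
    definite description in \<open>xy_pair\<close>.\<close>
  have "block_diagonal node_weights (xy_pair i e)" if "e \<in> Emix i" for i e
    using assms that by (metis card_2_iff xy_pair_doubleton block_diagonal_xy_term)
  then show ?thesis
    unfolding H_XY_def by (intro block_diagonal_scale_mat block_diagonal_sum)
qed

lemma block_diagonal_H_P: "block_diagonal f (H_P E)"
  by (simp add: block_diagonal_def H_P_def)

lemma dicke_nth_nonzero:
  assumes "dicke k $ x \<noteq> 0"
  shows "hamming_wt x = k"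
proof (rule ccontr)
  assume "hamming_wt x \<noteq> k"
  then have "(\<Sum>z | hamming_wt z = k. ket z $ x) = 0"
    by (intro sum.neutral) (auto simp: ket_def axis_def)
  with assms show False by (simp add: dicke_def)
qed

text \<open>An amplitude of the tensor product is a product over the nodes, so if it is nonzero,
  every node factor is nonzero and fixes the weight of its register.\<close>

lemma supported_on_tensor_nodes_dicke:
  fixes k :: "'a::finite \<Rightarrow> nat"
  shows "supported_on {x :: 'a \<times> 'b::finite \<Rightarrow> bool. node_weights x = k} (tensor_nodes (\<lambda>i. dicke (k i)))"
proof -
  have "node_weights x i = k i" if "tensor_nodes (\<lambda>i. dicke (k i)) $ x \<noteq> 0" for x :: "'a \<times> 'b \<Rightarrow> bool" and i
    using that dicke_nth_nonzero[of "k i" "\<lambda>c. x (i, c)"]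
    by (simp add: tensor_nodes_def node_weights_def hamming_wt_def)
  then show ?thesis by (auto simp: supported_on_def)
qed

text \<open>Induction on the number of layers: the Dicke product starts in the block with label
  \<open>k\<close>, and both exponentials of a layer preserve that block.\<close>

lemma supported_on_qaoa_state:
  assumes "\<forall>i. \<forall>e\<in>Emix i. card e = 2"
  shows "supported_on {x. node_weights x = k} (qaoa_state E Emix k \<gamma> \<beta> p)"
  by (induction p)
    (auto intro!: supported_on_tensor_nodes_dicke block_diagonal_supported_on block_diagonal_mat_exp
      block_diagonal_scale_mat block_diagonal_H_XY[OF assms] block_diagonal_H_P)

theorem mainTheorem1:
  fixes E :: "'n::finite set set"
    and Emix :: "'n \<Rightarrow> 'm::finite set set"
    and k :: "'n \<Rightarrow> nat"
  assumes simple_graph: "\<forall>e\<in>E. card e = 2"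
    and mixer_pairs: "\<forall>i. \<forall>e\<in>Emix i. card e = 2"
    and weights: "\<forall>i. k i \<le> CARD('m)"
  shows "(\<forall>i. H_XY Emix ** node_number_op i = node_number_op i ** H_XY Emix) \<and>
    (\<forall>p\<ge>1. \<forall>(\<gamma> :: nat \<Rightarrow> real) (\<beta> :: nat \<Rightarrow> real).
       qaoa_state E Emix k \<gamma> \<beta> p \<in> H_feas k \<and>
       (\<forall>x. outcome_prob (qaoa_state E Emix k \<gamma> \<beta> p) x \<noteq> 0 \<longrightarrow>
          (\<forall>i. (\<Sum>c\<in>UNIV. of_bool (x (i, c))) = k i)))"
proof (intro conjI allI impI)
  fix i
  show "H_XY Emix ** node_number_op i = node_number_op i ** H_XY Emix"
    unfolding node_number_op_eq
    \<comment> \<open>The diagonal entry of \<open>node_number_op i\<close> is coordinate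
      \<open>i\<close> of the label, which determines \<open>g\<close>.\<close>
    by (rule block_diagonal_commute[OF block_diagonal_H_XY[OF mixer_pairs], where g = "\<lambda>w. of_nat (w i)"])
next
  fix p :: nat and \<gamma> \<beta> :: "nat \<Rightarrow> real"
  note supp = supported_on_qaoa_state[OF mixer_pairs, of k E \<gamma> \<beta> p]
  show "qaoa_state E Emix k \<gamma> \<beta> p \<in> H_feas k"
    unfolding H_feas_def feasible_eq by (rule supported_on_imp_span_ket[OF supp])
  fix x i assume "outcome_prob (qaoa_state E Emix k \<gamma> \<beta> p) x \<noteq> 0"
  then show "(\<Sum>c\<in>UNIV. of_bool (x (i, c))) = k i"
    using supp by (auto simp: outcome_prob_def supported_on_def node_weights_def)
qed

end
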